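(* For every integer $r\geq 4$, $$\frac{r-2}{2(r-1)^2}\left(3r-4-\sqrt{5r^2-16r+12}\right)\leq \pi_{K_r}(\mathcal{T}_r)\leq \frac12-\frac{1}{4r-6}.$$
   Context: Graphs are finite and simple; $K_r$ is the complete graph on $r$ vertices. Let $H$ be a host graph. A (weighted) $H$-partite graph is a graph $G$ together with a canonical partition $V(G)=\bigsqcup_{x\in V(H)}V_x$ and a weight function $w:V(G)\to[0,1]$ such that (1) $\sum_{v\in V_x}w(v)=1$ for each $x\in V(H)$; (2) every edge of $G$ joins a vertex of $V_x$ to a vertex of $V_y$ for some $xy\in E(H)$. For $xy\in E(H)$ put $\alpha_{xy}:=\sum_{u\in V_x,\,v\in V_y}w(u)w(v)\mathbb{1}_{uv\in E(G)}$; the $H$-partite density of $G$ is $d_H(G):=\min\{\alpha_{xy}: xy\in E(H)\}$. A transversal of $G$ is a subgraph of $G$ induced by a set of vertices meeting each part $V_x$ in exactly one vertex (it is naturally viewed as a spanning subgraph of $H$). For a family $\mathcal{F}$ of graphs, $G$ has $\mathcal{F}$-free transversals if no transversal of $G$ contains a member of $\mathcal{F}$ as a subgraph, and $$\pi_H(\mathcal{F}):=\sup\{d_H(G): G\text{ is an }H\text{-partite graph with }\mathcal{F}\text{-free transversals}\}.$$ $\mathcal{T}_r$ denotes the family of all trees on $r$ vertices; thus for an $r$-vertex host graph $H$, $G$ has $\mathcal{T}_r$-free transversals if and only if no transversal of $G$ is connected. *)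

theory Defs
  imports Complex_Main "Graph_Theory.Graph_Theory"
begin

text \<open>
  A finite simple graph is a pair digraph satisfying the library predicate \<^const>\<open>pair_graph\<close>:
  finite, loopfree, symmetric. An undirected edge \<open>uv\<close> is thus represented by both arcs
  \<open>(u, v)\<close> and \<open>(v, u)\<close>.
\<close>

text \<open>
  In \<open>partite_graph H G V w\<close>, \<open>V x\<close> is the part belonging to the vertex \<open>x\<close> of \<open>H\<close>; the values of
  \<open>V\<close> outside the vertices of \<open>H\<close> and of \<open>w\<close> outside the vertices of \<open>G\<close> are irrelevant.
\<close>

definition partite_graph ::
  "'h pair_pre_digraph \<Rightarrow> 'v pair_pre_digraph \<Rightarrow> ('h \<Rightarrow> 'v set) \<Rightarrow> ('v \<Rightarrow> real) \<Rightarrow> bool" where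
  "partite_graph H G V w \<longleftrightarrow>
     pair_graph H \<and> pair_graph G \<and>
     pverts G = (\<Union>x\<in>pverts H. V x) \<and>
     (\<forall>x\<in>pverts H. \<forall>y\<in>pverts H. x \<noteq> y \<longrightarrow> V x \<inter> V y = {}) \<and>
     (\<forall>v\<in>pverts G. 0 \<le> w v \<and> w v \<le> 1) \<and>
     (\<forall>x\<in>pverts H. (\<Sum>v\<in>V x. w v) = 1) \<and>
     (\<forall>(u, v)\<in>parcs G. \<exists>(x, y)\<in>parcs H. u \<in> V x \<and> v \<in> V y)"

definition pair_density ::
  "'v pair_pre_digraph \<Rightarrow> ('h \<Rightarrow> 'v set) \<Rightarrow> ('v \<Rightarrow> real) \<Rightarrow> 'h \<Rightarrow> 'h \<Rightarrow> real" where
  "pair_density G V w x y =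
     (\<Sum>u\<in>V x. \<Sum>v\<in>V y. w u * w v * of_bool ((u, v) \<in> parcs G))"

text \<open>As usual for \<^const>\<open>Min\<close>, this is meaningful only if \<open>H\<close> has at least one edge.\<close>

definition partite_density ::
  "'h pair_pre_digraph \<Rightarrow> 'v pair_pre_digraph \<Rightarrow> ('h \<Rightarrow> 'v set) \<Rightarrow> ('v \<Rightarrow> real) \<Rightarrow> real" where
  "partite_density H G V w = Min {pair_density G V w x y | x y. (x, y) \<in> parcs H}"

definition transversal ::
  "'h pair_pre_digraph \<Rightarrow> 'v pair_pre_digraph \<Rightarrow> ('h \<Rightarrow> 'v set) \<Rightarrow> 'v pair_pre_digraph \<Rightarrow> bool" where
  "transversal H G V T \<longleftrightarrow>
     induced_subgraph (with_proj T) (with_proj G) \<and>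
     (\<forall>x\<in>pverts H. \<exists>!v. v \<in> V x \<and> v \<in> pverts T)"

text \<open>Containment as a not necessarily induced subgraph, up to isomorphism.\<close>

definition contains_graph :: "'v pair_pre_digraph \<Rightarrow> 'f pair_pre_digraph \<Rightarrow> bool" where
  "contains_graph G F \<longleftrightarrow>
     (\<exists>S :: 'v pair_pre_digraph.
        subgraph (with_proj S) (with_proj G) \<and> digraph_iso (with_proj F) (with_proj S))"

definition free_transversals ::
  "'h pair_pre_digraph \<Rightarrow> 'f pair_pre_digraph set \<Rightarrow> 'v pair_pre_digraph \<Rightarrow> ('h \<Rightarrow> 'v set) \<Rightarrow> bool" where
  "free_transversals H \<F> G V \<longleftrightarrow>
     (\<forall>T. transversal H G V T \<longrightarrow> \<not> (\<exists>F\<in>\<F>. contains_graph T F))"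

text \<open>
  Taking the vertices of \<open>G\<close> to be natural numbers is no restriction, since every finite graph is
  isomorphic to one on natural numbers.
\<close>

definition partite_threshold :: "'h pair_pre_digraph \<Rightarrow> 'f pair_pre_digraph set \<Rightarrow> real" where
  "partite_threshold H \<F> =
     Sup {partite_density H G V w | (G :: nat pair_pre_digraph) V w.
            partite_graph H G V w \<and> free_transversals H \<F> G V}"

text \<open>
  The library's \<^const>\<open>tree\<close> is not usable here: in a symmetric digraph every edge \<open>uv\<close> gives rise to
  the directed cycle \<open>u, v, u\<close>, so its notion of forest admits no edges. The cycles of an undirected
  simple graph are the directed cycles of length at least 3.
\<close>

definition undirected_tree :: "'a pair_pre_digraph \<Rightarrow> bool" where
  "undirected_tree T \<longleftrightarrow>
     pair_graph T \<and> Digraph_Component.connected (with_proj T) \<and>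
     \<not> (\<exists>p. pre_digraph.cycle (with_proj T) p \<and> 3 \<le> length p)"

text \<open>Up to isomorphism, all trees on \<open>r\<close> vertices.\<close>

definition trees :: "nat \<Rightarrow> nat pair_pre_digraph set" where
  "trees r = {T. undirected_tree T \<and> card (pverts T) = r}"

end

theory Submission
  imports Defs
begin

text \<open>
  Write \<open>\<alpha>\<close> for the density. The upper bound says that \<open>(2r - 3)\<alpha> > r - 2\<close> forces a connected
  transversal; equivalently, that \<open>(r - 1)\<alpha> > (r - 2)(1 - \<alpha>)\<close> does. Fix a part \<open>V\<^sub>0\<close>. By averaging, some
  \<open>v \<in> V\<^sub>0\<close> has degrees \<open>d\<^sub>i\<close> into the other parts with \<open>\<Sum>\<^sub>i d\<^sub>i \<ge> (r - 1)\<alpha> > (r - 2)(1 - \<alpha>)\<close>. Let \<open>S\<close> be the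
  set of parts with \<open>d\<^sub>i > 0\<close>, and \<open>K\<close> the set of the other parts with \<open>d\<^sub>i = 0\<close>, so that
  \<open>|S| + |K| = r - 1\<close>. The vertices of \<open>V\<^sub>i\<close> without a neighbour in a given \<open>V\<^sub>j\<close> have weight at most
  \<open>1 - \<alpha>\<close>; hence if \<open>d\<^sub>i > m(1 - \<alpha>)\<close>, then for any \<open>m\<close> parts there is a single neighbour of \<open>v\<close> in
  \<open>V\<^sub>i\<close> that has a neighbour in each of them (lemma \<open>exists_extending_neighbour\<close>). So part \<open>i \<in> S\<close> can
  serve \<open>m\<close> parts of \<open>K\<close> whenever \<open>m(1 - \<alpha>) < d\<^sub>i\<close>, and since the degrees sum to more than
  \<open>(|S| + |K| - 1)(1 - \<alpha>)\<close>, there is enough capacity to serve all of \<open>K\<close> (lemma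
  \<open>exists_assignment\<close>). The result is a spanning tree of depth two in a transversal: \<open>v\<close>, then one
  vertex in each part of \<open>S\<close>, then one in each part of \<open>K\<close>.

  The lower bound is a construction with \<open>c\<close> to be chosen. One special part has a vertex \<open>s\<^sub>x\<close> of weight
  \<open>1/(r - 1)\<close> for every other part \<open>x\<close>; every other part \<open>x\<close> has a vertex \<open>a\<^sub>x\<close> of weight \<open>1 - c\<close> and a vertex
  \<open>b\<^sub>x\<close> of weight \<open>c\<close>. The edges are \<open>a\<^sub>xa\<^sub>y\<close> and \<open>s\<^sub>xb\<^sub>y\<close> for \<open>x \<noteq> y\<close>. If a transversal contains some \<open>a\<^sub>x\<close>,
  the vertices \<open>a\<^sub>y\<close> in it are separated from the vertex of the special part; otherwise it
  consists of some \<open>s\<^sub>x\<close> and all vertices \<open>b\<^sub>y\<close>, and \<open>b\<^sub>x\<close> is isolated in it. The two kinds of pairs of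
  parts have densities \<open>(1 - c)\<^sup>2\<close> and \<open>c(r - 2)/(r - 1)\<close>, and the claimed bound is their common value
  for the \<open>c \<in> [0, 1]\<close> that makes them equal.
\<close>

section \<open>Trees and transversals\<close>

lemma pair_graphI:
  assumes "finite (pverts G)" "parcs G \<subseteq> pverts G \<times> pverts G"
    and "\<And>u v. (u, v) \<in> parcs G \<Longrightarrow> (v, u) \<in> parcs G"
    and "\<And>u. (u, u) \<notin> parcs G"
  shows "pair_graph G"
proof -
  have "finite (parcs G)"
    using assms(1,2) by (meson finite_SigmaI rev_finite_subset)
  then show ?thesis
    using assms by unfold_locales (auto simp: symmetric_def intro!: symI)
qed

lemma pair_graph_symD:
  assumes "pair_graph G" "(u, v) \<in> parcs G"
  shows "(v, u) \<in> parcs G"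
proof -
  interpret pair_graph G by fact
  show ?thesis using assms(2) by (rule arcs_symmetric)
qed

lemma pair_graph_verts:
  assumes "pair_graph G"
  shows "finite (pverts G)" "parcs G \<subseteq> pverts G \<times> pverts G" "(u, u) \<notin> parcs G"
proof -
  interpret pair_graph G by fact
  show "finite (pverts G)" by (rule pair_finite_verts)
  show "parcs G \<subseteq> pverts G \<times> pverts G" by (auto dest: wellformed')
  show "(u, u) \<notin> parcs G" using no_loops' by blast
qed

definition parent_graph :: "'a set \<Rightarrow> 'a \<Rightarrow> ('a \<Rightarrow> 'a) \<Rightarrow> 'a pair_pre_digraph" where
  "parent_graph A a p =
     \<lparr> pverts = A, parcs = (\<Union>x\<in>A - {a}. {(x, p x), (p x, x)}) \<rparr>"

lemma pcas_nth:
  assumes "pcas u q v" "i < length q"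
  shows "fst (q ! i) = (if i = 0 then u else snd (q ! (i - 1)))"
  using assms
proof (induction q arbitrary: u i)
  case (Cons e q)
  show ?case
  proof (cases i)
    case (Suc j)
    then show ?thesis using Cons.IH[of "snd e" j] Cons.prems by (cases j) auto
  qed (use Cons in auto)
qed simp

lemma pcas_last: "pcas u q v \<Longrightarrow> q \<noteq> [] \<Longrightarrow> snd (last q) = v"
  by (induction q arbitrary: u) auto

text \<open>
  The rank makes every vertex reach the root along parents. Two neighbours of a vertex of maximal rank
  on a cycle cannot be its children, so both are its parent; hence they coincide and the
  cycle has length at most two.
\<close>

lemma undirected_tree_parent_graph:
  fixes rank :: "'a \<Rightarrow> nat"
  assumes "finite A" "a \<in> A"
    and par: "\<And>x. x \<in> A - {a} \<Longrightarrow> p x \<in> A \<and> rank (p x) < rank x"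
  shows "undirected_tree (parent_graph A a p)"
proof -
  let ?T = "parent_graph A a p"
  have verts: "pverts ?T = A" by (simp add: parent_graph_def)
  have arc: "(x, y) \<in> parcs ?T \<longleftrightarrow> x \<in> A - {a} \<and> y = p x \<or> y \<in> A - {a} \<and> x = p y" for x y
    by (auto simp: parent_graph_def)
  have pg: "pair_graph ?T"
  proof (rule pair_graphI)
    show "(u, u) \<notin> parcs ?T" for u using par[of u] by (auto simp: arc)
  qed (use assms(1,2) par in \<open>auto simp: verts arc\<close>)
  then interpret T: pair_graph ?T .
  have reach: "x \<in> A \<Longrightarrow> x \<rightarrow>\<^sup>*\<^bsub>with_proj ?T\<^esub> a" for x
  proof (induction "rank x" arbitrary: x rule: less_induct)
    case less
    show ?case
    proof (cases "x = a")
      case False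
      then have "p x \<rightarrow>\<^sup>*\<^bsub>with_proj ?T\<^esub> a" "(x, p x) \<in> parcs ?T"
        using less par[of x] by (auto simp: arc)
      then show ?thesis by (metis T.adj_reachable_trans with_proj_simps(3))
    qed (use \<open>a \<in> A\<close> verts T.reachable_refl in auto)
  qed
  have "strongly_connected (with_proj ?T)"
  proof (rule strongly_connectedI)
    show "verts (with_proj ?T) \<noteq> {}" using \<open>a \<in> A\<close> by (auto simp: verts)
  next
    fix x y assume "x \<in> verts (with_proj ?T)" "y \<in> verts (with_proj ?T)"
    then have "x \<rightarrow>\<^sup>*\<^bsub>with_proj ?T\<^esub> a" "y \<rightarrow>\<^sup>*\<^bsub>with_proj ?T\<^esub> a"
      using reach by (auto simp: verts)
    then show "x \<rightarrow>\<^sup>*\<^bsub>with_proj ?T\<^esub> y"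
      using symmetric_reachable[OF T.sym_arcs] T.reachable_trans by blast
  qed
  then have conn: "Digraph_Component.connected (with_proj ?T)"
    by (simp add: Digraph_Component.connected_def strongly_connected_def
        T.reachable_mk_symmetric_eq[OF T.sym_arcs])
  have "\<not> (T.cycle q \<and> 3 \<le> length q)" for q
  proof
    assume q: "T.cycle q \<and> 3 \<le> length q"
    let ?n = "length q"
    from q obtain u where aw: "T.awalk u q u" and dist: "distinct (tl (pawalk_verts u q))"
      by (auto simp: T.cycle_def)
    have cas: "pcas u q u" and arcs: "set q \<subseteq> parcs ?T"
      using aw by (auto simp: T.awalk_def)
    have "pcas x q y \<Longrightarrow> pawalk_verts x q = x # map snd q" for x y
      by (induction q arbitrary: x) auto
    then have "pawalk_verts u q = u # map snd q" using cas .
    then have dist: "distinct (map snd q)" using dist by simp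
    define h where "h i = snd (q ! i)" for i
    have heq: "h i = h j \<longleftrightarrow> i = j" if "i < ?n" "j < ?n" for i j
      using dist that nth_eq_iff_index_eq[of "map snd q" i j] by (simp add: h_def)
    have step: "(h i, h (if Suc i = ?n then 0 else Suc i)) \<in> parcs ?T" if "i < ?n" for i
    proof -
      let ?j = "if Suc i = ?n then 0 else Suc i"
      have "h (?n - 1) = u"
        using pcas_last[OF cas] q last_conv_nth[of q] by (force simp: h_def)
      then have "fst (q ! ?j) = h i"
      proof (cases "Suc i = ?n")
        case True
        then have "i = ?n - 1" by simp
        with True \<open>h (?n - 1) = u\<close> pcas_nth[OF cas, of 0] that show ?thesis
          by (cases q) simp_all
      next
        case False
        with pcas_nth[OF cas, of "Suc i"] that show ?thesis by (simp add: h_def)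
      qed
      moreover have "q ! ?j \<in> parcs ?T" using arcs that by (auto intro!: subsetD[OF arcs] nth_mem)
      ultimately show ?thesis by (metis h_def prod.collapse)
    qed
    have "Max ((\<lambda>i. rank (h i)) ` {..<?n}) \<in> (\<lambda>i. rank (h i)) ` {..<?n}"
    proof (rule Max_in)
      have "0 \<in> {..<?n}" using q by auto
      then show "(\<lambda>i. rank (h i)) ` {..<?n} \<noteq> {}" by blast
    qed simp
    then obtain i where i: "i < ?n" and "rank (h i) = Max ((\<lambda>i. rank (h i)) ` {..<?n})" by auto
    then have imax: "rank (h j) \<le> rank (h i)" if "j < ?n" for j
      using that by simp
    \<comment> \<open>The indices cyclically before and after \<open>i\<close>; they differ because the length is at least 3.\<close>
    define i' where "i' = (if i = 0 then ?n - 1 else i - 1)"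
    define i'' where "i'' = (if Suc i = ?n then 0 else Suc i)"
    have idx: "i' < ?n" "i'' < ?n" "i' \<noteq> i''" using i q by (auto simp: i'_def i''_def)
    have "(h i', h i) \<in> parcs ?T"
      using step[of i'] i q by (cases i) (auto simp: i'_def)
    then have "h i' = p (h i)" using imax[OF idx(1)] par[of "h i'"] by (auto simp: arc)
    moreover have "(h i, h i'') \<in> parcs ?T" using step[OF i] by (simp add: i''_def)
    then have "h i'' = p (h i)" using imax[OF idx(2)] par[of "h i''"] by (auto simp: arc)
    ultimately show False using heq idx by metis
  qed
  then show ?thesis using pg conn unfolding undirected_tree_def by blast
qed

lemma digraph_iso_refl: "wf_digraph G \<Longrightarrow> digraph_iso G G"
  unfolding digraph_iso_def
  by (rule exI[of _ "\<lparr>iso_verts = id, iso_arcs = id, iso_head = head G, iso_tail = tail G\<rparr>"])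
    (simp add: pre_digraph.digraph_isomorphism_def app_iso_def)

text \<open>
  A spanning tree of \<open>H\<close>, given by a parent function, that lifts to \<open>G\<close> along a choice \<open>t\<close> of one vertex
  from each part is a tree in the transversal with vertices \<open>t\<close>.
\<close>

lemma tree_transversal:
  fixes G :: "nat pair_pre_digraph" and rank :: "'h \<Rightarrow> nat"
  assumes pg: "partite_graph H G V w" and "h0 \<in> pverts H"
    and t: "\<And>x. x \<in> pverts H \<Longrightarrow> t x \<in> V x"
    and par: "\<And>x. x \<in> pverts H - {h0} \<Longrightarrow>
      p x \<in> pverts H \<and> rank (p x) < rank x \<and> (t (p x), t x) \<in> parcs G"
  shows "\<not> free_transversals H (trees (card (pverts H))) G V"
proof -
  let ?P = "pverts H"
  have G: "pair_graph G" and H: "pair_graph H" and vG: "pverts G = (\<Union>x\<in>?P. V x)"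
    and disj: "\<And>u x y. u \<in> V x \<Longrightarrow> u \<in> V y \<Longrightarrow> x \<in> ?P \<Longrightarrow> y \<in> ?P \<Longrightarrow> x = y"
    using pg unfolding partite_graph_def by blast+
  have finP: "finite ?P" using pair_graph_verts(1)[OF H] .
  have inj: "inj_on t ?P" by (rule inj_onI) (metis t disj)
  define T where "T = \<lparr> pverts = t ` ?P, parcs = parcs G \<inter> (t ` ?P) \<times> (t ` ?P) \<rparr>"
  have Tsub: "t ` ?P \<subseteq> pverts G" using t vG by auto
  have T: "pair_graph T"
    using pair_graph_verts[OF G] pair_graph_symD[OF G] finP
    by (intro pair_graphI) (auto simp: T_def)
  have wf: "wf_digraph (with_proj X)" if "pair_graph X" for X :: "nat pair_pre_digraph"
    using that by (simp add: pair_digraph.axioms pair_fin_digraph.axioms(1) pair_graph.axioms(1) wf_digraph_wp_iff)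
  have trans: "transversal H G V T"
    unfolding transversal_def
  proof (intro conjI ballI)
    show "induced_subgraph (with_proj T) (with_proj G)"
      using Tsub wf[OF T] wf[OF G]
      by (auto simp: induced_subgraph_def subgraph_def compatible_def T_def)
    fix x assume "x \<in> ?P"
    then show "\<exists>!v. v \<in> V x \<and> v \<in> pverts T"
      using t disj by (intro ex1I[of _ "t x"]) (auto simp: T_def)
  qed
  let ?i = "inv_into ?P t"
  define S where "S = parent_graph (t ` ?P) (t h0) (\<lambda>u. t (p (?i u)))"
  have tree: "undirected_tree S"
    unfolding S_def
  proof (rule undirected_tree_parent_graph[where rank = "rank \<circ> ?i"])
    fix u assume "u \<in> t ` ?P - {t h0}"
    then obtain x where "x \<in> ?P - {h0}" "u = t x" by auto
    with par[of x] inj show "t (p (?i u)) \<in> t ` ?P \<and> (rank \<circ> ?i) (t (p (?i u))) < (rank \<circ> ?i) u"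
      by auto
  qed (use finP \<open>h0 \<in> ?P\<close> in auto)
  have "parcs S \<subseteq> parcs T"
  proof -
    have "(t x, t (p x)) \<in> parcs T" "(t (p x), t x) \<in> parcs T"
      if "x \<in> ?P" "t x \<noteq> t h0" for x
    proof -
      have "x \<in> ?P - {h0}" using that by auto
      then show "(t x, t (p x)) \<in> parcs T" "(t (p x), t x) \<in> parcs T"
        using par[of x] pair_graph_symD[OF G] by (auto simp: T_def)
    qed
    then show ?thesis using inj by (auto simp: S_def parent_graph_def) blast+
  qed
  moreover have "pair_graph S" using tree by (simp add: undirected_tree_def)
  ultimately have "subgraph (with_proj S) (with_proj T)"
    using wf T by (auto simp: subgraph_def compatible_def S_def T_def parent_graph_def)
  moreover have "digraph_iso (with_proj S) (with_proj S)"
    using wf[OF \<open>pair_graph S\<close>] by (rule digraph_iso_refl)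
  ultimately have "contains_graph T S" unfolding contains_graph_def by blast
  moreover have "S \<in> trees (card ?P)"
    using tree card_image[OF inj] by (simp add: trees_def S_def parent_graph_def)
  ultimately show ?thesis using trans unfolding free_transversals_def by blast
qed

lemma transversal_verts:
  assumes pg: "partite_graph H G V w" and T: "transversal H G V T"
  obtains t where "\<And>x. x \<in> pverts H \<Longrightarrow> t x \<in> V x" "inj_on t (pverts H)" "pverts T = t ` pverts H"
proof -
  let ?P = "pverts H"
  have vG: "pverts G = (\<Union>x\<in>?P. V x)"
    and disj: "\<And>u x y. u \<in> V x \<Longrightarrow> u \<in> V y \<Longrightarrow> x \<in> ?P \<Longrightarrow> y \<in> ?P \<Longrightarrow> x = y"
    using pg unfolding partite_graph_def by blast+
  have sub: "pverts T \<subseteq> pverts G"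
    using T by (auto simp: transversal_def induced_subgraph_def subgraph_def)
  have uniq: "\<forall>x\<in>?P. \<exists>!v. v \<in> V x \<and> v \<in> pverts T" using T by (simp add: transversal_def)
  then obtain t where t: "\<And>x. x \<in> ?P \<Longrightarrow> t x \<in> V x \<and> t x \<in> pverts T" by metis
  show ?thesis
  proof
    show "t x \<in> V x" if "x \<in> ?P" for x using t that by blast
    show "inj_on t ?P" by (rule inj_onI) (metis t disj)
    show "pverts T = t ` ?P"
    proof
      show "t ` ?P \<subseteq> pverts T" using t by auto
      show "pverts T \<subseteq> t ` ?P"
      proof
        fix u assume u: "u \<in> pverts T"
        then obtain x where "x \<in> ?P" "u \<in> V x" using sub vG by auto
        then show "u \<in> t ` ?P" using u t[of x] uniq by blast
      qed
    qed
  qed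
qed

text \<open>
  A tree with as many vertices as \<open>T\<close> would be spanning, hence would have an arc between \<open>A\<close> and its
  complement.
\<close>

lemma cut_imp_tree_free:
  fixes T :: "'v pair_pre_digraph"
  assumes "finite (pverts T)" "A \<subseteq> pverts T" "A \<noteq> {}" "A \<noteq> pverts T"
    and cut: "\<And>u v. (u, v) \<in> parcs T \<Longrightarrow> u \<in> A \<longleftrightarrow> v \<in> A"
    and F: "F \<in> trees (card (pverts T))"
  shows "\<not> contains_graph T F"
proof
  assume "contains_graph T F"
  then obtain S :: "'v pair_pre_digraph" where S: "subgraph (with_proj S) (with_proj T)"
    and iso: "digraph_iso (with_proj F) (with_proj S)"
    unfolding contains_graph_def by blast
  from iso obtain f where f: "pre_digraph.digraph_isomorphism (with_proj F) f"
    and Sf: "with_proj S = app_iso f (with_proj F)"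
    unfolding digraph_iso_def by auto
  have conF: "Digraph_Component.connected (with_proj F)" and cF: "card (pverts F) = card (pverts T)"
    using F by (auto simp: trees_def undirected_tree_def)
  have wfF: "wf_digraph (with_proj F)"
    using f by (simp add: pre_digraph.digraph_isomorphism_def)
  have conS: "Digraph_Component.connected (with_proj S)"
    unfolding Sf using wf_digraph.connectedI_app_iso[OF wfF conF f] .
  have "card (verts (with_proj S)) = card (verts (with_proj F))"
    unfolding Sf verts_app_iso by (rule card_verts_iso[OF f])
  then have "card (pverts S) = card (pverts T)" using cF by simp
  moreover have SS: "pverts S \<subseteq> pverts T" "parcs S \<subseteq> parcs T" using S by (auto simp: subgraph_def)
  ultimately have vS: "pverts S = pverts T" using card_subset_eq[OF assms(1)] by blast
  obtain u v where uv: "u \<in> A" "v \<in> pverts T" "v \<notin> A" using assms(2-4) by auto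
  have "(u, v) \<in> rtrancl_on (pverts S) ((parcs S)\<^sup>s)"
    using conS uv vS assms(2) by (auto simp: connected_conv)
  then have "u \<in> A \<longrightarrow> v \<in> A"
  proof (induction)
    case (step x y)
    then show ?case using cut SS by (auto simp: symcl_def)
  qed simp
  with uv show False by simp
qed

section \<open>The upper bound: a tree of depth two\<close>

text \<open>
  Distributing items over bins: bin \<open>i\<close> may receive \<open>m\<close> items whenever \<open>m * c < d i\<close>. Induction on the
  items works because the hypothesis drops by exactly \<open>c\<close> on both sides when an item goes to a bin
  with \<open>d i > c\<close>, and such a bin exists since the average of \<open>d\<close> exceeds \<open>c\<close> as long as an item is left.
\<close>

lemma exists_assignment:
  fixes d :: "'a \<Rightarrow> real"
  assumes "finite K" "finite S" "0 \<le> c" "\<And>i. i \<in> S \<Longrightarrow> 0 < d i"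
    and "(real (card S) + real (card K) - 1) * c < sum d S"
  shows "\<exists>f. f ` K \<subseteq> S \<and> (\<forall>i\<in>S. real (card {j\<in>K. f j = i}) * c < d i)"
  using assms
proof (induction K arbitrary: d rule: finite_induct)
  case (insert j K)
  have "sum d S > real (card S) * c"
  proof -
    have "real (card S) * c \<le> (real (card S) + real (card K)) * c"
      using insert.prems(2) by (intro mult_right_mono) auto
    with insert show ?thesis by simp
  qed
  then obtain i where i: "i \<in> S" "c < d i"
    using sum_bounded_above[of S d c] by (metis not_less)
  define d' where "d' = d(i := d i - c)"
  have "sum d' S = sum d S - c"
    using i(1) insert.prems(1) sum.cong[of "S - {i}" "S - {i}" d' d]
    by (simp add: d'_def sum.remove[of S i])
  then have "(real (card S) + real (card K) - 1) * c < sum d' S"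
    using insert by (simp add: algebra_simps)
  moreover have "0 < d' k" if "k \<in> S" for k using i insert.prems that by (simp add: d'_def)
  ultimately obtain f where f: "f ` K \<subseteq> S" "\<forall>k\<in>S. real (card {l\<in>K. f l = k}) * c < d' k"
    using insert.IH[of d'] insert.prems by blast
  show ?case
  proof (intro exI[of _ "f(j := i)"] conjI ballI)
    show "(f(j := i)) ` insert j K \<subseteq> S" using f i insert.hyps by auto
    fix k assume k: "k \<in> S"
    have "{l \<in> insert j K. (f(j := i)) l = k} =
        (if k = i then insert j {l\<in>K. f l = k} else {l\<in>K. f l = k})"
      using insert.hyps by auto
    then show "real (card {l \<in> insert j K. (f(j := i)) l = k}) * c < d k"
      using f(2) k insert.hyps by (auto simp: d'_def algebra_simps split: if_splits)
  qed
qed (auto)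

definition weighted_degree ::
  "'v pair_pre_digraph \<Rightarrow> ('h \<Rightarrow> 'v set) \<Rightarrow> ('v \<Rightarrow> real) \<Rightarrow> 'v \<Rightarrow> 'h \<Rightarrow> real" where
  "weighted_degree G V w v y = (\<Sum>u\<in>V y. w u * of_bool ((v, u) \<in> parcs G))"

lemma pair_density_weighted_degree:
  "pair_density G V w x y = (\<Sum>v\<in>V x. w v * weighted_degree G V w v y)"
  by (simp add: pair_density_def weighted_degree_def sum_distrib_left mult.assoc)

lemma partite_graphD:
  assumes "partite_graph H G V w"
  shows "pair_graph H" "pair_graph G" "x \<in> pverts H \<Longrightarrow> finite (V x)"
    "x \<in> pverts H \<Longrightarrow> u \<in> V x \<Longrightarrow> 0 \<le> w u" "x \<in> pverts H \<Longrightarrow> sum w (V x) = 1"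
proof -
  show "pair_graph H" and G: "pair_graph G" using assms by (auto simp: partite_graph_def)
  show "x \<in> pverts H \<Longrightarrow> finite (V x)"
    using assms pair_graph_verts(1)[OF G] by (metis UN_upper finite_subset partite_graph_def)
  show "x \<in> pverts H \<Longrightarrow> u \<in> V x \<Longrightarrow> 0 \<le> w u" "x \<in> pverts H \<Longrightarrow> sum w (V x) = 1"
    using assms by (auto simp: partite_graph_def)
qed

lemma weighted_degree_bounds:
  assumes pg: "partite_graph H G V w" and y: "y \<in> pverts H"
  shows "0 \<le> weighted_degree G V w v y" "weighted_degree G V w v y \<le> 1"
proof -
  show "0 \<le> weighted_degree G V w v y"
    using partite_graphD(4)[OF pg y] by (auto simp: weighted_degree_def intro!: sum_nonneg)
  have "weighted_degree G V w v y \<le> sum w (V y)"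
    unfolding weighted_degree_def
    using partite_graphD(4)[OF pg y] by (intro sum_mono) auto
  then show "weighted_degree G V w v y \<le> 1" using partite_graphD(5)[OF pg y] by simp
qed

text \<open>
  Every vertex contributes to the density at most its own weight, and nothing unless it has a
  neighbour in the other part.
\<close>

lemma pair_density_le_touched:
  assumes pg: "partite_graph H G V w" and xy: "x \<in> pverts H" "y \<in> pverts H"
  shows "pair_density G V w x y \<le> (\<Sum>u\<in>V x. w u * of_bool (\<exists>z\<in>V y. (u, z) \<in> parcs G))"
  unfolding pair_density_weighted_degree
proof (intro sum_mono mult_left_mono)
  fix u assume "u \<in> V x"
  then show "0 \<le> w u" using partite_graphD(4)[OF pg] xy by blast
  show "weighted_degree G V w u y \<le> of_bool (\<exists>z\<in>V y. (u, z) \<in> parcs G)"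
  proof (cases "\<exists>z\<in>V y. (u, z) \<in> parcs G")
    case False
    then have "weighted_degree G V w u y = 0" by (auto simp: weighted_degree_def intro!: sum.neutral)
    then show ?thesis by simp
  qed (use weighted_degree_bounds(2)[OF pg xy(2)] in simp)
qed

text \<open>
  A union bound: were the claim false, every neighbour of \<open>v\<close> in \<open>V i\<close> would lie in one of \<open>card J\<close> sets, each
  of weight at most \<open>1 - a\<close>.
\<close>

lemma exists_extending_neighbour:
  assumes pg: "partite_graph H G V w" and i: "i \<in> pverts H" and J: "J \<subseteq> pverts H"
    and dens: "\<And>j. j \<in> J \<Longrightarrow> a \<le> pair_density G V w i j"
    and large: "real (card J) * (1 - a) < weighted_degree G V w v i"
  shows "\<exists>u\<in>V i. (v, u) \<in> parcs G \<and> (\<forall>j\<in>J. \<exists>z\<in>V j. (u, z) \<in> parcs G)"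
proof (rule ccontr)
  assume none: "\<not> ?thesis"
  define touched where "touched u j \<longleftrightarrow> (\<exists>z\<in>V j. (u, z) \<in> parcs G)" for u j
  have "finite J" using J pair_graph_verts(1)[OF partite_graphD(1)[OF pg]] finite_subset by blast
  have "weighted_degree G V w v i \<le> (\<Sum>u\<in>V i. \<Sum>j\<in>J. w u * of_bool (\<not> touched u j))"
    unfolding weighted_degree_def
  proof (rule sum_mono)
    fix u assume u: "u \<in> V i"
    then have w: "0 \<le> w u" using partite_graphD(4)[OF pg i] by blast
    have "of_bool ((v, u) \<in> parcs G) \<le> (\<Sum>j\<in>J. of_bool (\<not> touched u j) :: real)"
    proof (cases "(v, u) \<in> parcs G")
      case True
      then obtain j where "j \<in> J" "\<not> touched u j" using none u by (auto simp: touched_def)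
      then show ?thesis
        using member_le_sum[of j J "\<lambda>j. of_bool (\<not> touched u j) :: real"] \<open>finite J\<close> True by simp
    qed (simp add: sum_nonneg)
    then show "w u * of_bool ((v, u) \<in> parcs G) \<le> (\<Sum>j\<in>J. w u * of_bool (\<not> touched u j))"
      unfolding sum_distrib_left[symmetric] using w by (rule mult_left_mono)
  qed
  also have "\<dots> = (\<Sum>j\<in>J. \<Sum>u\<in>V i. w u * of_bool (\<not> touched u j))" by (rule sum.swap)
  also have "\<dots> \<le> (\<Sum>j\<in>J. 1 - a)"
  proof (rule sum_mono)
    fix j assume j: "j \<in> J"
    have "(\<Sum>u\<in>V i. w u * of_bool (\<not> touched u j)) + (\<Sum>u\<in>V i. w u * of_bool (touched u j)) = sum w (V i)"
      unfolding sum.distrib[symmetric] by (rule sum.cong) auto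
    moreover have "a \<le> (\<Sum>u\<in>V i. w u * of_bool (touched u j))"
      using pair_density_le_touched[OF pg i, of j] dens[OF j] j J unfolding touched_def by force
    ultimately show "(\<Sum>u\<in>V i. w u * of_bool (\<not> touched u j)) \<le> 1 - a"
      using partite_graphD(5)[OF pg i] by simp
  qed
  also have "\<dots> = real (card J) * (1 - a)" by simp
  finally show False using large by simp
qed

lemma complete_arcs:
  assumes "K\<^bsub>r\<^esub> (with_proj H)"
  shows "pair_graph H" "card (pverts H) = r" "finite (pverts H)"
    "(x, y) \<in> parcs H \<longleftrightarrow> x \<in> pverts H \<and> y \<in> pverts H \<and> x \<noteq> y"
  using assms pair_graphI_complete[OF assms] by (auto simp: complete_digraph_pair_def)

lemma partite_density_set:
  "{pair_density G V w x y | x y. (x, y) \<in> parcs H} = (\<lambda>(x, y). pair_density G V w x y) ` parcs H"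
  by auto

lemma partite_density_le:
  assumes "pair_graph H" "(x, y) \<in> parcs H"
  shows "partite_density H G V w \<le> pair_density G V w x y"
proof -
  have "finite (parcs H)"
    using pair_graph_verts(1,2)[OF assms(1)] by (meson finite_SigmaI rev_finite_subset)
  then show ?thesis
    using assms(2) unfolding partite_density_def partite_density_set by (intro Min_le) auto
qed

text \<open>
  A larger density \<open>a\<close> leaves room for a spanning tree of depth two in some transversal: with
  \<open>c = 1 - a\<close>, the degrees of a good root \<open>v\<close> satisfy the capacity condition of \<open>exists_assignment\<close>.
\<close>

lemma density_bound_of_free_transversals:
  fixes G :: "nat pair_pre_digraph"
  assumes K: "K\<^bsub>r\<^esub> (with_proj H)" and r: "2 \<le> r"
    and pg: "partite_graph H G V w" and free: "free_transversals H (trees r) G V"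
  shows "(2 * real r - 3) * partite_density H G V w \<le> real r - 2"
proof (rule ccontr)
  assume *: "\<not> ?thesis"
  define a where "a = partite_density H G V w"
  let ?P = "pverts H" and ?d = "weighted_degree G V w"
  note H = complete_arcs[OF K]
  have large: "real r - 2 < (2 * real r - 3) * a" using * by (simp add: a_def)
  have dens: "a \<le> pair_density G V w x y" if "x \<in> ?P" "y \<in> ?P" "x \<noteq> y" for x y
    unfolding a_def using partite_density_le[OF H(1)] H(4) that by blast
  obtain h0 where h0: "h0 \<in> ?P" using H(2) r by fastforce
  define Q where "Q = ?P - {h0}"
  have finQ: "finite Q" and cQ: "card Q = r - 1" using H h0 by (auto simp: Q_def)
  \<comment> \<open>Averaging over the part of the root: a vertex whose total degree is at least the mean.\<close>
  have "\<exists>v\<in>V h0. real (r - 1) * a \<le> (\<Sum>y\<in>Q. ?d v y)"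
  proof (rule ccontr)
    assume *: "\<not> ?thesis"
    have "real (r - 1) * a = (\<Sum>y\<in>Q. a)" by (simp add: cQ)
    also have "\<dots> \<le> (\<Sum>y\<in>Q. pair_density G V w h0 y)"
      using dens h0 by (intro sum_mono) (auto simp: Q_def)
    also have "\<dots> = (\<Sum>v\<in>V h0. w v * (\<Sum>y\<in>Q. ?d v y))"
      by (simp add: pair_density_weighted_degree sum_distrib_left sum.swap[of _ _ Q])
    also have "\<dots> < (\<Sum>v\<in>V h0. w v * (real (r - 1) * a))"
    proof (rule sum_strict_mono_ex1)
      show "finite (V h0)" using partite_graphD(3)[OF pg h0] .
      show "\<forall>v\<in>V h0. w v * (\<Sum>y\<in>Q. ?d v y) \<le> w v * (real (r - 1) * a)"
        using * partite_graphD(4)[OF pg h0] by (intro ballI mult_left_mono) force+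
      have "\<exists>v\<in>V h0. w v \<noteq> 0"
        using partite_graphD(5)[OF pg h0] by (metis sum.neutral zero_neq_one)
      then show "\<exists>v\<in>V h0. w v * (\<Sum>y\<in>Q. ?d v y) < w v * (real (r - 1) * a)"
        using * partite_graphD(4)[OF pg h0] by (meson less_eq_real_def mult_strict_left_mono not_le)
    qed
    also have "\<dots> = real (r - 1) * a"
      unfolding sum_distrib_right[symmetric] by (simp add: partite_graphD(5)[OF pg h0])
    finally show False by simp
  qed
  then obtain v where v: "v \<in> V h0" and dv: "real (r - 1) * a \<le> (\<Sum>y\<in>Q. ?d v y)" by blast
  define S where "S = {y\<in>Q. 0 < ?d v y}"
  define K where "K = Q - S"
  have SK: "S \<subseteq> Q" "K \<subseteq> Q" "S \<inter> K = {}" "Q = S \<union> K" "finite S" "finite K"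
    using finQ by (auto simp: S_def K_def)
  have "card S + card K = r - 1"
    using cQ SK card_Un_disjoint[of S K] by simp
  then have "real (card S) + real (card K) - 1 = real r - 2" using r by linarith
  moreover have "sum (?d v) S = sum (?d v) Q"
    using finQ weighted_degree_bounds(1)[OF pg, of _ v]
    by (intro sum.mono_neutral_left) (force simp: S_def Q_def)+
  moreover have "(real r - 2) * (1 - a) < real (r - 1) * a"
    using large r by (simp add: algebra_simps of_nat_diff)
  ultimately have big: "(real (card S) + real (card K) - 1) * (1 - a) < sum (?d v) S"
    using dv by (metis order_less_le_trans)
  have "Q \<noteq> {}" using cQ r by auto
  then obtain y where y: "y \<in> Q" by blast
  have "a \<le> pair_density G V w h0 y" using dens y h0 by (auto simp: Q_def)
  also have "\<dots> \<le> (\<Sum>u\<in>V h0. w u * of_bool (\<exists>z\<in>V y. (u, z) \<in> parcs G))"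
    using pair_density_le_touched[OF pg h0] y by (auto simp: Q_def)
  also have "\<dots> \<le> sum w (V h0)"
    using partite_graphD(4)[OF pg h0] by (intro sum_mono) auto
  finally have nonneg: "0 \<le> 1 - a" using partite_graphD(5)[OF pg h0] by simp
  have pos: "0 < ?d v i" if "i \<in> S" for i using that by (simp add: S_def)
  obtain f where fK: "f ` K \<subseteq> S"
    and f: "\<forall>i\<in>S. real (card {j\<in>K. f j = i}) * (1 - a) < ?d v i"
    using exists_assignment[where d = "?d v", OF SK(6,5) nonneg pos big] by blast
  \<comment> \<open>A hub is a neighbour of \<open>v\<close> through which all parts assigned to \<open>i\<close> can be reached.\<close>
  define hub where "hub i u \<longleftrightarrow> u \<in> V i \<and> (v, u) \<in> parcs G \<and>
    (\<forall>j\<in>{j\<in>K. f j = i}. \<exists>z\<in>V j. (u, z) \<in> parcs G)" for i u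
  have "\<exists>u. hub i u" if i: "i \<in> S" for i
  proof -
    have "\<exists>u\<in>V i. (v, u) \<in> parcs G \<and> (\<forall>j\<in>{j\<in>K. f j = i}. \<exists>z\<in>V j. (u, z) \<in> parcs G)"
    proof (rule exists_extending_neighbour[OF pg, where a = a])
      show "i \<in> ?P" "{j\<in>K. f j = i} \<subseteq> ?P" using i SK by (auto simp: Q_def)
      show "a \<le> pair_density G V w i j" if "j \<in> {j\<in>K. f j = i}" for j
        using that i SK by (intro dens) (auto simp: Q_def)
      show "real (card {j\<in>K. f j = i}) * (1 - a) < ?d v i" using f i by blast
    qed
    then show ?thesis unfolding hub_def by blast
  qed
  then obtain g where g: "\<And>i. i \<in> S \<Longrightarrow> hub i (g i)" by metis
  have "\<exists>z. z \<in> V j \<and> (g (f j), z) \<in> parcs G" if "j \<in> K" for j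
  proof -
    have "hub (f j) (g (f j))" using g fK that by blast
    then show ?thesis using that unfolding hub_def by blast
  qed
  then obtain h where h: "\<And>j. j \<in> K \<Longrightarrow> h j \<in> V j \<and> (g (f j), h j) \<in> parcs G" by metis
  \<comment> \<open>The tree of depth two: the root \<open>v\<close>, the hubs in \<open>S\<close>, the leaves in \<open>K\<close> below their hubs.\<close>
  define t where "t x = (if x = h0 then v else if x \<in> S then g x else h x)" for x
  define p where "p x = (if x \<in> S then h0 else f x)" for x
  define rank where "rank x = (if x = h0 then 0 else if x \<in> S then 1 else 2 :: nat)" for x
  have P: "x \<in> ?P \<longleftrightarrow> x = h0 \<or> x \<in> S \<or> x \<in> K" for x using SK h0 by (auto simp: Q_def)
  have sep: "h0 \<notin> S" "h0 \<notin> K" "\<And>x. x \<in> K \<Longrightarrow> x \<notin> S" using SK by (auto simp: Q_def)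
  have "\<not> free_transversals H (trees (card ?P)) G V"
  proof (rule tree_transversal[OF pg h0, where t = t and p = p and rank = rank])
    show "t x \<in> V x" if "x \<in> ?P" for x
      using that v g h unfolding P hub_def by (auto simp: t_def)
    fix x assume "x \<in> ?P - {h0}"
    then consider "x \<in> S" | "x \<in> K" "x \<notin> S" "f x \<in> S" using P fK sep by auto
    then show "p x \<in> ?P \<and> rank (p x) < rank x \<and> (t (p x), t x) \<in> parcs G"
    proof cases
      case 1
      then show ?thesis using g h0 sep by (auto simp: p_def rank_def t_def hub_def)
    next
      case 2
      moreover have "x \<noteq> h0" "f x \<noteq> h0" using 2 sep by auto
      ultimately show ?thesis using h P by (auto simp: p_def rank_def t_def)
    qed
  qed
  with free H(2) show False by simp
qed

section \<open>The lower bound: a construction\<close>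

definition special_vertex :: "('h \<Rightarrow> nat) \<Rightarrow> 'h \<Rightarrow> nat" where
  "special_vertex e x = prod_encode (0, e x)"

definition clique_vertex :: "('h \<Rightarrow> nat) \<Rightarrow> 'h \<Rightarrow> nat" where
  "clique_vertex e x = prod_encode (1, e x)"

definition independent_vertex :: "('h \<Rightarrow> nat) \<Rightarrow> 'h \<Rightarrow> nat" where
  "independent_vertex e x = prod_encode (2, e x)"

text \<open>
  The construction for an arbitrary weight \<open>c\<close>; \<open>e\<close> serves only to encode the vertices as
  natural numbers.
\<close>

locale isolating_construction =
  fixes H :: "'h pair_pre_digraph" and r :: nat and e :: "'h \<Rightarrow> nat" and h0 :: 'h and c :: real
  assumes complete: "K\<^bsub>r\<^esub> (with_proj H)" and r: "3 \<le> r"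
    and h0: "h0 \<in> pverts H" and inj_e: "inj_on e (pverts H)"
    and c: "0 \<le> c" "c \<le> 1"
begin

abbreviation "Q \<equiv> pverts H - {h0}"
abbreviation "s \<equiv> special_vertex e"
abbreviation "a \<equiv> clique_vertex e"
abbreviation "b \<equiv> independent_vertex e"

lemmas vertex_defs = special_vertex_def clique_vertex_def independent_vertex_def

lemma vertex_distinct: "s x \<noteq> a y" "s x \<noteq> b y" "a x \<noteq> b y" "a x \<noteq> s y" "b x \<noteq> s y" "b x \<noteq> a y"
  by (simp_all add: vertex_defs)

lemma vertex_inj:
  assumes "x \<in> pverts H" "y \<in> pverts H"
  shows "s x = s y \<longleftrightarrow> x = y" "a x = a y \<longleftrightarrow> x = y" "b x = b y \<longleftrightarrow> x = y"
  using assms inj_e by (auto simp: vertex_defs inj_on_def)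

definition part :: "'h \<Rightarrow> nat set" where
  "part x = (if x = h0 then s ` Q else {a x, b x})"

definition weight :: "nat \<Rightarrow> real" where
  "weight n = (let k = fst (prod_decode n) in
     if k = 0 then 1 / (real r - 1) else if k = 1 then 1 - c else c)"

definition isolating_graph :: "nat pair_pre_digraph" where
  "isolating_graph = \<lparr> pverts = (\<Union>x\<in>pverts H. part x),
     parcs = {(a x, a y) | x y. x \<in> Q \<and> y \<in> Q \<and> x \<noteq> y} \<union>
       {(s x, b y) | x y. x \<in> Q \<and> y \<in> Q \<and> x \<noteq> y} \<union>
       {(b y, s x) | x y. x \<in> Q \<and> y \<in> Q \<and> x \<noteq> y} \<rparr>"

lemma weight_simps: "weight (s x) = 1 / (real r - 1)" "weight (a x) = 1 - c" "weight (b x) = c"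
  by (simp_all add: weight_def vertex_defs)

lemma finite_Q: "finite Q" and card_Q: "real (card Q) = real r - 1"
  using complete_arcs[OF complete] h0 r by (auto simp: of_nat_diff)

lemma sum_special: "(\<Sum>u\<in>s ` Q. F u) = (\<Sum>x\<in>Q. F (s x))"
  by (rule sum.reindex_cong[of s]) (auto simp: inj_on_def vertex_inj)

lemma arcs_iff:
  assumes "x \<in> Q" "y \<in> Q"
  shows "(a x, a y) \<in> parcs isolating_graph \<longleftrightarrow> x \<noteq> y"
    "(s x, b y) \<in> parcs isolating_graph \<longleftrightarrow> x \<noteq> y"
    "(b x, s y) \<in> parcs isolating_graph \<longleftrightarrow> x \<noteq> y"
    "(a x, b y) \<notin> parcs isolating_graph" "(b x, a y) \<notin> parcs isolating_graph"
    "(b x, b y) \<notin> parcs isolating_graph"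
    "(s x, a y) \<notin> parcs isolating_graph" "(a x, s y) \<notin> parcs isolating_graph"
    "(s x, s y) \<notin> parcs isolating_graph"
  using assms by (auto simp: isolating_graph_def vertex_distinct vertex_inj)

lemma isolating_graph_arcE:
  assumes "(u, v) \<in> parcs isolating_graph"
  obtains x y where "x \<in> Q" "y \<in> Q" "x \<noteq> y" "u = a x" "v = a y"
  | x y where "x \<in> Q" "y \<in> Q" "x \<noteq> y" "u = s x" "v = b y"
  | x y where "x \<in> Q" "y \<in> Q" "x \<noteq> y" "u = b x" "v = s y"
  using assms by (auto simp: isolating_graph_def)

lemma part_h0: "part h0 = s ` Q" and part_Q: "x \<in> Q \<Longrightarrow> part x = {a x, b x}"
  by (auto simp: part_def)

lemma pair_graph_isolating_graph: "pair_graph isolating_graph"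
proof (rule pair_graphI)
  show "finite (pverts isolating_graph)"
    using complete_arcs(3)[OF complete] finite_Q by (auto simp: isolating_graph_def part_def)
  show "parcs isolating_graph \<subseteq> pverts isolating_graph \<times> pverts isolating_graph"
  proof (rule subrelI)
    fix u v assume "(u, v) \<in> parcs isolating_graph"
    then show "(u, v) \<in> pverts isolating_graph \<times> pverts isolating_graph"
      using h0 by (cases rule: isolating_graph_arcE) (auto simp: isolating_graph_def part_def)
  qed
  show "(v, u) \<in> parcs isolating_graph" if "(u, v) \<in> parcs isolating_graph" for u v
    using that by (cases rule: isolating_graph_arcE) (auto simp: arcs_iff)
  show "(u, u) \<notin> parcs isolating_graph" for u
    by (auto elim!: isolating_graph_arcE simp: vertex_distinct vertex_inj)
qed

lemma partite_isolating_graph: "partite_graph H isolating_graph part weight"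
  unfolding partite_graph_def
proof (intro conjI)
  show "pair_graph H" using complete_arcs(1)[OF complete] .
  show "pair_graph isolating_graph" by (rule pair_graph_isolating_graph)
  show "pverts isolating_graph = (\<Union>x\<in>pverts H. part x)" by (simp add: isolating_graph_def)
  show "\<forall>x\<in>pverts H. \<forall>y\<in>pverts H. x \<noteq> y \<longrightarrow> part x \<inter> part y = {}"
    by (auto simp: part_def vertex_distinct vertex_inj)
  show "\<forall>v\<in>pverts isolating_graph. 0 \<le> weight v \<and> weight v \<le> 1"
    using c r by (auto simp: weight_def Let_def)
  show "\<forall>x\<in>pverts H. sum weight (part x) = 1"
  proof
    fix x assume "x \<in> pverts H"
    then show "sum weight (part x) = 1"
      using card_Q r by (cases "x = h0") (auto simp: part_def sum_special weight_simps vertex_distinct)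
  qed
  show "\<forall>(u, v)\<in>parcs isolating_graph. \<exists>(x, y)\<in>parcs H. u \<in> part x \<and> v \<in> part y"
  proof clarify
    fix u v assume "(u, v) \<in> parcs isolating_graph"
    then show "\<exists>(x, y)\<in>parcs H. u \<in> part x \<and> v \<in> part y"
    proof (cases rule: isolating_graph_arcE)
      case (1 x y)
      then show ?thesis using complete_arcs(4)[OF complete] by (intro bexI[of _ "(x, y)"]) (auto simp: part_def)
    next
      case (2 x y)
      then show ?thesis using complete_arcs(4)[OF complete] h0 by (intro bexI[of _ "(h0, y)"]) (auto simp: part_def)
    next
      case (3 x y)
      then show ?thesis using complete_arcs(4)[OF complete] h0 by (intro bexI[of _ "(x, h0)"]) (auto simp: part_def)
    qed
  qed
qed

lemma pair_density_special:
  assumes y: "y \<in> Q"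
  shows "pair_density isolating_graph part weight h0 y = c * (real r - 2) / (real r - 1)"
    and "pair_density isolating_graph part weight y h0 = c * (real r - 2) / (real r - 1)"
proof -
  have cardQ': "real (card (Q - {y})) = real r - 2"
    using y finite_Q card_Q r by (auto simp: of_nat_diff)
  have "(\<Sum>x\<in>Q. of_bool (x \<noteq> y) * (c / (real r - 1))) = (\<Sum>x\<in>Q - {y}. c / (real r - 1))"
    using finite_Q by (intro sum.mono_neutral_cong_right) auto
  also have "\<dots> = c * (real r - 2) / (real r - 1)" using cardQ' by simp
  finally have S: "(\<Sum>x\<in>Q. of_bool (x \<noteq> y) * (c / (real r - 1))) = c * (real r - 2) / (real r - 1)" .
  show "pair_density isolating_graph part weight h0 y = c * (real r - 2) / (real r - 1)"
    unfolding S[symmetric] pair_density_def part_h0 part_Q[OF y] sum_special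
    using y by (intro sum.cong) (auto simp: arcs_iff weight_simps vertex_distinct)
  have "pair_density isolating_graph part weight y h0 = (\<Sum>x\<in>Q. of_bool (x \<noteq> y) * (c / (real r - 1)))"
    unfolding pair_density_def part_h0 part_Q[OF y] sum_special
    using y by (simp add: arcs_iff weight_simps vertex_distinct) (intro sum.cong, auto simp: arcs_iff)
  with S show "pair_density isolating_graph part weight y h0 = c * (real r - 2) / (real r - 1)" by simp
qed

lemma pair_density_ordinary:
  assumes "x \<in> Q" "y \<in> Q" "x \<noteq> y"
  shows "pair_density isolating_graph part weight x y = (1 - c)\<^sup>2"
  unfolding pair_density_def part_Q[OF assms(1)] part_Q[OF assms(2)]
  using assms by (simp add: arcs_iff weight_simps vertex_distinct power2_eq_square)

lemma partite_density_isolating_graph: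
  assumes "(1 - c)\<^sup>2 = c * (real r - 2) / (real r - 1)"
  shows "partite_density H isolating_graph part weight = (1 - c)\<^sup>2"
proof -
  have "pair_density isolating_graph part weight x y = (1 - c)\<^sup>2" if "(x, y) \<in> parcs H" for x y
    using that pair_density_special[of x] pair_density_special[of y] pair_density_ordinary[of x y] assms
      complete_arcs(4)[OF complete] by (cases "x = h0"; cases "y = h0") auto
  moreover have "\<exists>x y. (x, y) \<in> parcs H"
  proof -
    have "Q \<noteq> {}"
    proof
      assume "Q = {}"
      then have "real (card Q) = 0" by (metis card.empty of_nat_0)
      with card_Q r show False by simp
    qed
    then show ?thesis using complete_arcs(4)[OF complete] h0 by blast
  qed
  ultimately have "{pair_density isolating_graph part weight x y | x y. (x, y) \<in> parcs H} = {(1 - c)\<^sup>2}"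
    by (auto, metis)
  then show ?thesis by (simp add: partite_density_def)
qed

text \<open>
  Every transversal has a nontrivial cut without edges: its clique vertices if there are any,
  and otherwise the single independent vertex whose part is the index of the special vertex chosen.
\<close>

lemma free_isolating_graph: "free_transversals H (trees r) isolating_graph part"
  unfolding free_transversals_def
proof (intro allI impI)
  fix T assume T: "transversal H isolating_graph part T"
  obtain t where t: "\<And>x. x \<in> pverts H \<Longrightarrow> t x \<in> part x" and inj: "inj_on t (pverts H)"
    and vT: "pverts T = t ` pverts H"
    using transversal_verts[OF partite_isolating_graph T] by blast
  have fin: "finite (pverts T)" and card: "card (pverts T) = r"
    using vT complete_arcs[OF complete] card_image[OF inj] by auto
  have "parcs T = {e \<in> parcs isolating_graph. fst e \<in> pverts T \<and> snd e \<in> pverts T}"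
    using T by (simp add: transversal_def induced_subgraph_def)
  then have sub: "parcs T \<subseteq> parcs isolating_graph" "\<And>u v. (u, v) \<in> parcs T \<Longrightarrow> u \<in> pverts T \<and> v \<in> pverts T"
    by auto
  obtain z where z: "z \<in> Q" "t h0 = s z" using t[OF h0] by (auto simp: part_h0)
  have "\<exists>A. A \<subseteq> pverts T \<and> A \<noteq> {} \<and> A \<noteq> pverts T \<and> (\<forall>(u, v)\<in>parcs T. u \<in> A \<longleftrightarrow> v \<in> A)"
  proof (cases "\<exists>x\<in>Q. t x = a x")
    case True
    let ?A = "pverts T \<inter> a ` Q"
    have "s z \<in> pverts T" using z(2) vT h0 by (auto intro: rev_image_eqI)
    moreover have "s z \<notin> ?A" by (auto simp: vertex_distinct)
    moreover obtain x where "x \<in> Q" "t x = a x" using True by blast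
    then have "a x \<in> ?A" using vT by (auto intro: rev_image_eqI)
    ultimately have ne: "?A \<noteq> {}" "?A \<noteq> pverts T" by blast+
    have cut: "\<forall>(u, v)\<in>parcs T. u \<in> ?A \<longleftrightarrow> v \<in> ?A"
    proof clarify
      fix u v assume uv: "(u, v) \<in> parcs T"
      then have "(u, v) \<in> parcs isolating_graph" using sub by auto
      then show "u \<in> ?A \<longleftrightarrow> v \<in> ?A"
        using sub(2)[OF uv] by (cases rule: isolating_graph_arcE) (auto simp: vertex_distinct)
    qed
    show ?thesis by (intro exI[of _ ?A] conjI ne cut) blast
  next
    case False
    then have tb: "t x = b x" if "x \<in> Q" for x using t[of x] that part_Q[OF that] by auto
    have inT: "u = s z \<or> (\<exists>x\<in>Q. u = b x)" if "u \<in> pverts T" for u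
      using that vT z tb by (cases "u = s z") auto
    have "b z \<in> pverts T" "s z \<in> pverts T" using tb z vT h0 by (auto intro: rev_image_eqI)
    moreover have "u \<noteq> b z \<and> v \<noteq> b z" if uv: "(u, v) \<in> parcs T" for u v
    proof -
      have "(u, v) \<in> parcs isolating_graph" using sub uv by auto
      then show ?thesis
        using inT[of u] inT[of v] sub(2)[OF uv] z
        by (cases rule: isolating_graph_arcE) (auto simp: vertex_distinct vertex_inj)
    qed
    moreover have "s z \<noteq> b z" by (simp add: vertex_distinct)
    ultimately show ?thesis by (intro exI[of _ "{b z}"]) blast
  qed
  then obtain A where "A \<subseteq> pverts T" "A \<noteq> {}" "A \<noteq> pverts T" "\<forall>(u, v)\<in>parcs T. u \<in> A \<longleftrightarrow> v \<in> A"
    by blast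
  then have "\<not> contains_graph T F" if "F \<in> trees r" for F :: "nat pair_pre_digraph"
    using cut_imp_tree_free[OF fin, of A F] that card by blast
  then show "\<not> (\<exists>F\<in>trees r. contains_graph T F)" by blast
qed

end

text \<open>
  The weight \<open>c\<close> is the smaller root of \<open>(r - 1)(1 - c)\<^sup>2 = (r - 2)c\<close>, a quadratic with discriminant
  \<open>5r\<^sup>2 - 16r + 12\<close>. Writing this discriminant as \<open>(r - 2)\<^sup>2 + 4(r - 2)(r - 1)\<close> gives \<open>c \<le> 1\<close>.
\<close>

lemma balancing_weight:
  fixes r :: real
  assumes "r \<ge> 3"
  defines "c \<equiv> (3 * r - 4 - sqrt (5 * r^2 - 16 * r + 12)) / (2 * (r - 1))"
  shows "0 \<le> c" "c \<le> 1" "(1 - c)\<^sup>2 = c * (r - 2) / (r - 1)"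
    "c * (r - 2) / (r - 1) = (r - 2) / (2 * (r - 1)^2) * (3 * r - 4 - sqrt (5 * r^2 - 16 * r + 12))"
proof -
  define D where "D = sqrt (5 * r^2 - 16 * r + 12)"
  have "5 * r^2 - 16 * r + 12 = (r - 2)\<^sup>2 + 4 * ((r - 2) * (r - 1))"
    by (simp add: power2_eq_square algebra_simps)
  moreover have "0 \<le> (r - 2) * (r - 1)" using assms by simp
  ultimately have D1: "r - 2 \<le> D" and D2: "D\<^sup>2 = 5 * r^2 - 16 * r + 12"
    by (auto simp: D_def intro!: real_le_rsqrt)
  have "(3 * r - 4)\<^sup>2 - D\<^sup>2 = 4 * (r - 1)\<^sup>2" unfolding D2 by (simp add: power2_eq_square algebra_simps)
  then have "D\<^sup>2 \<le> (3 * r - 4)\<^sup>2" by (smt (verit) zero_le_power2)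
  then have D3: "D \<le> 3 * r - 4" using power2_le_imp_le[of D "3 * r - 4"] assms(1) by linarith
  have cD: "2 * (r - 1) * c = 3 * r - 4 - D" using assms(1) by (simp add: c_def D_def)
  show "0 \<le> c" "c \<le> 1" using assms(1) D1 D3 by (simp_all add: c_def flip: D_def)
  have "(2 * (r - 1) * c - (3 * r - 4))\<^sup>2 = D\<^sup>2" unfolding cD by (simp add: power2_eq_square algebra_simps)
  then have "4 * (r - 1) * ((r - 1) * (1 - c)\<^sup>2) = 4 * (r - 1) * (c * (r - 2))"
    unfolding D2 by (simp add: power2_eq_square algebra_simps)
  then have "(r - 1) * (1 - c)\<^sup>2 = c * (r - 2)" using assms(1) by simp
  then show "(1 - c)\<^sup>2 = c * (r - 2) / (r - 1)" using assms(1) by (simp add: field_simps)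
  show "c * (r - 2) / (r - 1) = (r - 2) / (2 * (r - 1)^2) * (3 * r - 4 - sqrt (5 * r^2 - 16 * r + 12))"
  proof -
    have "X / (2 * m) * k / m = k / (2 * m\<^sup>2) * X" for X k m :: real
      by (simp add: power2_eq_square mult_ac)
    then show ?thesis unfolding c_def .
  qed
qed

section \<open>The bounds on the threshold\<close>

theorem theorem1p7:
  fixes r :: nat and H :: "'h pair_pre_digraph"
  assumes "r \<ge> 4"
    and "K\<^bsub>r\<^esub> (with_proj H)"
  shows "(real r - 2) / (2 * (real r - 1)^2) *
           (3 * real r - 4 - sqrt (5 * (real r)^2 - 16 * real r + 12))
         \<le> partite_threshold H (trees r)
       \<and> partite_threshold H (trees r) \<le> 1 / 2 - 1 / (4 * real r - 6)"
proof -
  let ?D = "{partite_density H G V w | (G :: nat pair_pre_digraph) V w.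
    partite_graph H G V w \<and> free_transversals H (trees r) G V}"
  let ?c = "(3 * real r - 4 - sqrt (5 * (real r)^2 - 16 * real r + 12)) / (2 * (real r - 1))"
  have bound: "1 / 2 - 1 / (4 * real r - 6) = (real r - 2) / (2 * real r - 3)"
    using assms(1) by (simp add: field_simps)
  have upper: "d \<le> 1 / 2 - 1 / (4 * real r - 6)" if "d \<in> ?D" for d
  proof -
    have "(2 * real r - 3) * d \<le> real r - 2"
      using that density_bound_of_free_transversals[OF assms(2)] assms(1) by auto
    then show ?thesis
      unfolding bound using assms(1) by (simp add: pos_le_divide_eq mult.commute)
  qed
  note H = complete_arcs[OF assms(2)]
  have "pverts H \<noteq> {}" using H(2) assms(1) by auto
  then obtain h0 where h0: "h0 \<in> pverts H" by blast
  obtain e :: "'h \<Rightarrow> nat" where e: "inj_on e (pverts H)"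
    using finite_imp_inj_to_nat_seg[OF H(3)] by metis
  have r3: "3 \<le> real r" using assms(1) by simp
  interpret isolating_construction H r e h0 ?c
    using assms h0 e balancing_weight(1,2)[OF r3] by unfold_locales auto
  have "(real r - 2) / (2 * (real r - 1)^2) *
      (3 * real r - 4 - sqrt (5 * (real r)^2 - 16 * real r + 12)) =
      partite_density H isolating_graph part weight"
    using partite_density_isolating_graph balancing_weight(3,4)[OF r3] by metis
  also have "\<dots> \<in> ?D" using partite_isolating_graph free_isolating_graph by blast
  finally have lower: "(real r - 2) / (2 * (real r - 1)^2) *
      (3 * real r - 4 - sqrt (5 * (real r)^2 - 16 * real r + 12)) \<in> ?D" .
  show ?thesis
    unfolding partite_threshold_def
  proof
    show "(real r - 2) / (2 * (real r - 1)^2) *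
        (3 * real r - 4 - sqrt (5 * (real r)^2 - 16 * real r + 12)) \<le> Sup ?D"
      by (rule cSup_upper[OF lower], rule bdd_aboveI, erule upper)
    show "Sup ?D \<le> 1 / 2 - 1 / (4 * real r - 6)"
    proof (rule cSup_least)
      show "?D \<noteq> {}" using lower by (metis empty_iff)
    qed (erule upper)
  qed
qed

end
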